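(* Let $n\ge 2$ be an integer. For every real $\varepsilon$ with $0<\varepsilon<1/2$ there exists a code $C$ of blocklength $n$ such that $C$ is linear or Class-I, and $C$ is optimal at $\varepsilon$, i.e. $\lambda_C(\varepsilon)\ge\lambda_D(\varepsilon)$ for every code $D$ of blocklength $n$.
   Context: A code of blocklength $n$ (an "$(n,4)$ code") is here an arbitrary $4\times n$ binary matrix $C$ (repeated rows are allowed), with rows (codewords) $r_0,r_1,r_2,r_3\in\{0,1\}^n$ and $n$ columns in $\{0,1\}^4$. For $y\in\{0,1\}^n$ let $d_C(y)=\min_{0\le j\le 3} d_H(r_j,y)$, where $d_H$ is Hamming distance, and $$\lambda_C(\varepsilon)=\tfrac14\sum_{y\in\{0,1\}^n}(1-\varepsilon)^{n-d_C(y)}\varepsilon^{d_C(y)}.$$ The type of a column $(b_0,b_1,b_2,b_3)^T$ ($b_j$ the entry in row $j$) is the integer $8b_0+4b_1+2b_2+b_3\in\{0,\dots,15\}$. $|i|_C$ denotes the number of columns of $C$ of type $i$. Linear: $C$ is linear if every column has type in $\{0,3,5,6\}$ and at least two of $|3|_C,|5|_C,|6|_C$ are positive. Class-I: $C$ is Class-I if every column has type in $\{1,3,5,6\}$ (that is, $|1|_C+|3|_C+|5|_C+|6|_C=n$), $|1|_C$ is odd, and $|3|_C,|5|_C,|6|_C$ are all even or all odd. *)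

theory Defs
  imports Complex_Main "HOL-Library.FuncSet"
begin

(* Coordinates are 0, ..., n - 1; bits are the naturals 0 and 1. *)
definition binary_words :: "nat \<Rightarrow> (nat \<Rightarrow> nat) set" where
  "binary_words n = {..<n} \<rightarrow>\<^sub>E {0, 1}"

(* C j i is the entry in row j and column i. Repeated rows are allowed. *)
definition codes :: "nat \<Rightarrow> (nat \<Rightarrow> nat \<Rightarrow> nat) set" where
  "codes n = {..<4} \<rightarrow>\<^sub>E binary_words n"

definition hamming_dist :: "nat \<Rightarrow> (nat \<Rightarrow> nat) \<Rightarrow> (nat \<Rightarrow> nat) \<Rightarrow> nat" where
  "hamming_dist n x y = card {i. i < n \<and> x i \<noteq> y i}"

definition code_dist :: "nat \<Rightarrow> (nat \<Rightarrow> nat \<Rightarrow> nat) \<Rightarrow> (nat \<Rightarrow> nat) \<Rightarrow> nat" where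
  "code_dist n C y = Min ((\<lambda>j. hamming_dist n (C j) y) ` {..<4})"

(* The exponent n - code_dist n C y is a subtraction of naturals, but never truncates. *)
definition success_prob :: "nat \<Rightarrow> (nat \<Rightarrow> nat \<Rightarrow> nat) \<Rightarrow> real \<Rightarrow> real" where
  "success_prob n C \<epsilon> =
    1 / 4 * (\<Sum>y\<in>binary_words n. (1 - \<epsilon>) ^ (n - code_dist n C y) * \<epsilon> ^ code_dist n C y)"

definition column_type :: "(nat \<Rightarrow> nat \<Rightarrow> nat) \<Rightarrow> nat \<Rightarrow> nat" where
  "column_type C i = 8 * C 0 i + 4 * C 1 i + 2 * C 2 i + C 3 i"

definition type_count :: "nat \<Rightarrow> (nat \<Rightarrow> nat \<Rightarrow> nat) \<Rightarrow> nat \<Rightarrow> nat" where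
  "type_count n C t = card {i. i < n \<and> column_type C i = t}"

definition linear_code :: "nat \<Rightarrow> (nat \<Rightarrow> nat \<Rightarrow> nat) \<Rightarrow> bool" where
  "linear_code n C \<longleftrightarrow>
    (\<forall>i<n. column_type C i \<in> {0, 3, 5, 6}) \<and>
    card {t \<in> {3, 5, 6}. type_count n C t > 0} \<ge> 2"

definition class_I_code :: "nat \<Rightarrow> (nat \<Rightarrow> nat \<Rightarrow> nat) \<Rightarrow> bool" where
  "class_I_code n C \<longleftrightarrow>
    (\<forall>i<n. column_type C i \<in> {1, 3, 5, 6}) \<and>
    odd (type_count n C 1) \<and>
    ((\<forall>t\<in>{3, 5, 6}. even (type_count n C t)) \<or> (\<forall>t\<in>{3, 5, 6}. odd (type_count n C t)))"

definition optimal_code :: "nat \<Rightarrow> real \<Rightarrow> (nat \<Rightarrow> nat \<Rightarrow> nat) \<Rightarrow> bool" where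
  "optimal_code n \<epsilon> C \<longleftrightarrow>
    C \<in> codes n \<and> (\<forall>D\<in>codes n. success_prob n C \<epsilon> \<ge> success_prob n D \<epsilon>)"

end

theory Submission
  imports Defs "HOL-Combinatorics.Transposition"
begin

text \<open>
  Everything rests on what a single column contributes to the success probability. Fix a coordinate
  \<open>c\<close> and group the received words into pairs that differ only at \<open>c\<close>. Let \<open>m\<close> be the smallest
  distance, measured off \<open>c\<close>, from such a pair to the four rows, and call the rows at distance \<open>m\<close>
  nearest. If the column at \<open>c\<close> takes both values on the nearest rows, both words of the pair lie at
  distance \<open>m\<close> from the code; otherwise one of them lies at distance \<open>m\<close> and the other at distance
  \<open>m + 1\<close>. So a column may be exchanged for any column that separates the nearest rows of every word
  for which the old one did (\<open>success_prob_mono_column\<close>).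

  Two rows that are both nearest to some word have even distance off \<open>c\<close>, by parity. Hence, if the
  column at \<open>c\<close> isolates a row \<open>j\<close> from the three others and some other row \<open>i\<close> has even distance
  from row \<open>j\<close>, that distance is odd off \<open>c\<close>, the rows \<open>i\<close> and \<open>j\<close> are never nearest together, and
  the balanced column that separates rows \<open>i\<close> and \<open>j\<close> from the other two is at least as good. A
  constant column separates nothing, so it may be exchanged for any column.

  Consider therefore an optimal code with as few unbalanced columns as possible. Each of its
  unbalanced columns isolates a row that has odd distance from all three others, and two different
  rows cannot both have this property, since distances are additive modulo 2. Complementing columns
  and permuting rows does not affect the success probability. If there are unbalanced columns, this
  turns them all into type 1, and the odd distances are precisely the parity condition defining
  Class-I. If there are none, all types are 3, 5 or 6; the code is linear unless all its columns
  coincide, and then one column may be exchanged, because whenever the common column separates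
  nearest rows, all four rows are nearest.
\<close>

section \<open>Words and Hamming distance\<close>

definition off_dist :: "nat \<Rightarrow> nat \<Rightarrow> (nat \<Rightarrow> nat) \<Rightarrow> (nat \<Rightarrow> nat) \<Rightarrow> nat" where
  "off_dist n c x y = card {i. i < n \<and> i \<noteq> c \<and> x i \<noteq> y i}"

lemma hamming_dist_off_dist:
  assumes "c < n"
  shows "hamming_dist n x y = off_dist n c x y + (if x c = y c then 0 else 1)"
proof -
  have "{i. i < n \<and> x i \<noteq> y i} =
      {i. i < n \<and> i \<noteq> c \<and> x i \<noteq> y i} \<union> (if x c = y c then {} else {c})"
    using assms by auto
  then show ?thesis
    by (simp add: hamming_dist_def off_dist_def)
qed

lemma off_dist_less:
  assumes "c < n"
  shows "off_dist n c x y < n"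
proof -
  have "off_dist n c x y \<le> card ({..<n} - {c})"
    unfolding off_dist_def by (intro card_mono) auto
  also have "\<dots> < n"
    using assms by simp
  finally show ?thesis .
qed

lemma off_dist_cong:
  assumes "\<And>i. i < n \<Longrightarrow> i \<noteq> c \<Longrightarrow> x i = x' i" and "\<And>i. i < n \<Longrightarrow> i \<noteq> c \<Longrightarrow> y i = y' i"
  shows "off_dist n c x y = off_dist n c x' y'"
proof -
  have "{i. i < n \<and> i \<noteq> c \<and> x i \<noteq> y i} = {i. i < n \<and> i \<noteq> c \<and> x' i \<noteq> y' i}"
    using assms by auto
  then show ?thesis
    by (simp add: off_dist_def)
qed

lemma binary_words_bit:
  assumes "x \<in> binary_words n" and "i < n"
  shows "x i = 0 \<or> x i = 1"
  using assms by (auto simp: binary_words_def PiE_def Pi_def)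

lemma binary_words_update:
  assumes "x \<in> binary_words n" "c < n" "v \<in> {0, 1}"
  shows "x(c := v) \<in> binary_words n"
  using assms by (auto simp: binary_words_def PiE_def Pi_def extensional_def)

text \<open>
  Over two symbols, the positions where \<open>x\<close> and \<open>z\<close> differ form the symmetric difference of those
  where \<open>x\<close> differs from \<open>y\<close> and those where \<open>z\<close> does; its size is the sum of theirs modulo 2.
\<close>

lemma even_card_differences:
  fixes x y z :: "nat \<Rightarrow> nat"
  assumes fin: "finite I" and bits: "\<And>i. i \<in> I \<Longrightarrow> {x i, y i, z i} \<subseteq> {0, 1}"
  shows "even (card {i\<in>I. x i \<noteq> y i} + card {i\<in>I. z i \<noteq> y i} + card {i\<in>I. x i \<noteq> z i})"
proof -
  let ?X = "{i\<in>I. x i \<noteq> y i}" and ?Z = "{i\<in>I. z i \<noteq> y i}" and ?D = "{i\<in>I. x i \<noteq> z i}"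
  have "card ?X + card ?Z = card (?X \<union> ?Z) + card (?X \<inter> ?Z)"
    using fin by (intro card_Un_Int) auto
  moreover have "?X \<union> ?Z = ?D \<union> (?X \<inter> ?Z)"
    using bits by auto
  moreover have "?D \<inter> (?X \<inter> ?Z) = {}"
    using bits by fastforce
  then have "card (?D \<union> (?X \<inter> ?Z)) = card ?D + card (?X \<inter> ?Z)"
    using fin by (intro card_Un_disjoint) auto
  ultimately have "card ?X + card ?Z = card ?D + 2 * card (?X \<inter> ?Z)"
    by simp
  then show ?thesis
    by simp
qed

lemma even_off_dist_triangle:
  assumes x: "x \<in> binary_words n" and y: "y \<in> binary_words n" and z: "z \<in> binary_words n"
  shows "even (off_dist n c x y + off_dist n c z y + off_dist n c x z)"
proof -
  have "off_dist n c u v = card {i \<in> {..<n} - {c}. u i \<noteq> v i}" for u v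
    unfolding off_dist_def by (rule arg_cong[where f = card]) auto
  moreover have "{x i, y i, z i} \<subseteq> {0, 1}" if "i \<in> {..<n} - {c}" for i
    using that binary_words_bit[OF x, of i] binary_words_bit[OF y, of i] binary_words_bit[OF z, of i]
    by auto
  ultimately show ?thesis
    using even_card_differences[of "{..<n} - {c}" x y z] by simp
qed

lemma even_hamming_dist_triangle:
  assumes x: "x \<in> binary_words n" and y: "y \<in> binary_words n" and z: "z \<in> binary_words n"
  shows "even (hamming_dist n x y + hamming_dist n z y + hamming_dist n x z)"
proof -
  have "hamming_dist n u v = card {i \<in> {..<n}. u i \<noteq> v i}" for u v
    unfolding hamming_dist_def by (rule arg_cong[where f = card]) auto
  moreover have "{x i, y i, z i} \<subseteq> {0, 1}" if "i \<in> {..<n}" for i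
    using that binary_words_bit[OF x, of i] binary_words_bit[OF y, of i] binary_words_bit[OF z, of i]
    by auto
  ultimately show ?thesis
    using even_card_differences[of "{..<n}" x y z] by simp
qed

lemma hamming_dist_commute: "hamming_dist n x y = hamming_dist n y x"
  by (simp add: hamming_dist_def eq_commute)

lemma codes_row: "C \<in> codes n \<Longrightarrow> j < 4 \<Longrightarrow> C j \<in> binary_words n"
  by (auto simp: codes_def PiE_def Pi_def)

lemma codes_bit: "C \<in> codes n \<Longrightarrow> j < 4 \<Longrightarrow> c < n \<Longrightarrow> C j c = 0 \<or> C j c = 1"
  by (rule binary_words_bit[OF codes_row])

lemma finite_binary_words: "finite (binary_words n)"
  by (auto simp: binary_words_def intro!: finite_PiE)

lemma finite_codes: "finite (codes n)"
  by (auto simp: codes_def finite_binary_words intro!: finite_PiE)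

lemma less_4_iff: "j < 4 \<longleftrightarrow> j = 0 \<or> j = 1 \<or> j = 2 \<or> j = (3::nat)"
  by auto

lemma all_less_4: "(\<forall>j<4. P j) \<longleftrightarrow> P 0 \<and> P 1 \<and> P 2 \<and> P (3::nat)"
  by (auto simp: less_4_iff)

lemma ex_less_4: "(\<exists>j<4. P j) \<longleftrightarrow> P 0 \<or> P 1 \<or> P 2 \<or> P (3::nat)"
  by (auto simp: less_4_iff)

section \<open>Exchanging one column\<close>

definition likelihood :: "nat \<Rightarrow> real \<Rightarrow> nat \<Rightarrow> real" where
  "likelihood n \<epsilon> d = (1 - \<epsilon>) ^ (n - d) * \<epsilon> ^ d"

lemma likelihood_Suc_le:
  assumes "0 < \<epsilon>" "\<epsilon> < 1 / 2" "d < n"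
  shows "likelihood n \<epsilon> (Suc d) \<le> likelihood n \<epsilon> d"
proof -
  have "likelihood n \<epsilon> (Suc d) = (1 - \<epsilon>) ^ (n - Suc d) * \<epsilon> ^ d * \<epsilon>"
    by (simp add: likelihood_def)
  also have "\<dots> \<le> (1 - \<epsilon>) ^ (n - Suc d) * \<epsilon> ^ d * (1 - \<epsilon>)"
    using assms by (intro mult_left_mono) auto
  also have "\<dots> = likelihood n \<epsilon> d"
    using assms by (simp add: likelihood_def Suc_diff_Suc[symmetric])
  finally show ?thesis .
qed

definition nearest_rows :: "nat \<Rightarrow> nat \<Rightarrow> (nat \<Rightarrow> nat \<Rightarrow> nat) \<Rightarrow> (nat \<Rightarrow> nat) \<Rightarrow> nat set" where
  "nearest_rows n c C y = {j. j < 4 \<and> (\<forall>k<4. off_dist n c (C j) y \<le> off_dist n c (C k) y)}"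

definition separates :: "(nat \<Rightarrow> nat) \<Rightarrow> nat set \<Rightarrow> bool" where
  "separates b A \<longleftrightarrow> (\<exists>i\<in>A. \<exists>j\<in>A. b i \<noteq> b j)"

definition off_code_dist :: "nat \<Rightarrow> nat \<Rightarrow> (nat \<Rightarrow> nat \<Rightarrow> nat) \<Rightarrow> (nat \<Rightarrow> nat) \<Rightarrow> nat" where
  "off_code_dist n c C y = Min ((\<lambda>j. off_dist n c (C j) y) ` {..<4})"

lemma off_code_dist_le: "j < 4 \<Longrightarrow> off_code_dist n c C y \<le> off_dist n c (C j) y"
  by (auto simp: off_code_dist_def intro!: Min_le)

lemma off_code_dist_attained:
  obtains k where "k < 4" "off_dist n c (C k) y = off_code_dist n c C y"
proof -
  have "off_code_dist n c C y \<in> (\<lambda>j. off_dist n c (C j) y) ` {..<4}"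
    unfolding off_code_dist_def by (rule Min_in) (auto simp: lessThan_empty_iff)
  then show ?thesis
    using that by auto
qed

lemma nearest_rows_iff:
  "j \<in> nearest_rows n c C y \<longleftrightarrow> j < 4 \<and> off_dist n c (C j) y = off_code_dist n c C y"
proof (intro iffI conjI)
  assume j: "j \<in> nearest_rows n c C y"
  then show "j < 4"
    by (simp add: nearest_rows_def)
  obtain k where "k < 4" and k: "off_dist n c (C k) y = off_code_dist n c C y"
    by (rule off_code_dist_attained)
  then have "off_dist n c (C j) y \<le> off_dist n c (C k) y"
    using j unfolding nearest_rows_def by blast
  then show "off_dist n c (C j) y = off_code_dist n c C y"
    using off_code_dist_le[OF \<open>j < 4\<close>, of n c C y] k by simp
next
  assume "j < 4 \<and> off_dist n c (C j) y = off_code_dist n c C y"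
  then show "j \<in> nearest_rows n c C y"
    using off_code_dist_le by (simp add: nearest_rows_def)
qed

lemma nearest_rows_nonempty: "nearest_rows n c C y \<noteq> {}"
proof -
  obtain k where "k < 4" "off_dist n c (C k) y = off_code_dist n c C y"
    by (rule off_code_dist_attained)
  then show ?thesis
    by (auto simp: nearest_rows_iff set_eq_iff)
qed

lemma code_dist_off_code_dist:
  assumes "c < n"
  shows "code_dist n C y = off_code_dist n c C y +
    (if \<exists>j\<in>nearest_rows n c C y. C j c = y c then 0 else 1)"
proof (cases "\<exists>j\<in>nearest_rows n c C y. C j c = y c")
  case True
  then obtain j where j: "j \<in> nearest_rows n c C y" "C j c = y c"
    by auto
  have "code_dist n C y = off_code_dist n c C y"
    unfolding code_dist_def
  proof (rule Min_eqI)
    show "off_code_dist n c C y \<in> (\<lambda>j. hamming_dist n (C j) y) ` {..<4}"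
      using j by (auto simp: nearest_rows_iff hamming_dist_off_dist[OF assms] image_iff
          intro!: bexI[of _ j])
  qed (auto simp: hamming_dist_off_dist[OF assms] off_code_dist_le trans_le_add1)
  then show ?thesis
    using True by simp
next
  case False
  obtain j where j: "j \<in> nearest_rows n c C y"
    using nearest_rows_nonempty by blast
  have le: "off_code_dist n c C y + 1 \<le> hamming_dist n (C k) y" if "k < 4" for k
  proof (cases "k \<in> nearest_rows n c C y")
    case True
    then show ?thesis
      using False by (auto simp: nearest_rows_iff hamming_dist_off_dist[OF assms])
  next
    case False
    then have "off_code_dist n c C y < off_dist n c (C k) y"
      using that off_code_dist_le[OF that, of n c C y] by (auto simp: nearest_rows_iff)
    then show ?thesis
      by (simp add: hamming_dist_off_dist[OF assms])
  qed
  have "code_dist n C y = off_code_dist n c C y + 1"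
    unfolding code_dist_def
  proof (rule Min_eqI)
    show "off_code_dist n c C y + 1 \<in> (\<lambda>j. hamming_dist n (C j) y) ` {..<4}"
      using j False by (auto simp: nearest_rows_iff hamming_dist_off_dist[OF assms] image_iff
          intro!: bexI[of _ j])
  qed (auto simp: le[simplified])
  then show ?thesis
    using False by simp
qed

definition flip :: "nat \<Rightarrow> (nat \<Rightarrow> nat) \<Rightarrow> nat \<Rightarrow> nat" where
  "flip c y = y(c := 1 - y c)"

lemma flip_apply: "flip c y i = (if i = c then 1 - y c else y i)"
  by (simp add: flip_def)

lemma flip_binary_words: "c < n \<Longrightarrow> y \<in> binary_words n \<Longrightarrow> flip c y \<in> binary_words n"
  using binary_words_bit[of y n c] unfolding flip_def by (intro binary_words_update) auto

lemma flip_flip: "c < n \<Longrightarrow> y \<in> binary_words n \<Longrightarrow> flip c (flip c y) = y"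
  using binary_words_bit[of y n c] by (auto simp: flip_def fun_eq_iff)

lemma likelihood_flip_pair:
  assumes C: "C \<in> codes n" and c: "c < n" and y: "y \<in> binary_words n"
  shows "likelihood n \<epsilon> (code_dist n C y) + likelihood n \<epsilon> (code_dist n C (flip c y)) =
    likelihood n \<epsilon> (off_code_dist n c C y) +
    likelihood n \<epsilon> (off_code_dist n c C y +
      (if separates (\<lambda>j. C j c) (nearest_rows n c C y) then 0 else 1))"
proof -
  let ?A = "nearest_rows n c C y"
  have off: "off_dist n c x (flip c y) = off_dist n c x y" for x
    by (rule off_dist_cong) (auto simp: flip_apply)
  have m: "off_code_dist n c C (flip c y) = off_code_dist n c C y"
    and A: "nearest_rows n c C (flip c y) = ?A"
    by (simp_all only: off_code_dist_def nearest_rows_def off)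
  have bit: "C j c = 0 \<or> C j c = 1" if "j \<in> ?A" for j
    using that codes_bit[OF C _ c] by (auto simp: nearest_rows_iff)
  have yc: "y c = 0 \<or> y c = 1"
    using binary_words_bit[OF y c] .
  obtain j where j: "j \<in> ?A"
    using nearest_rows_nonempty by blast
  show ?thesis
  proof (cases "separates (\<lambda>j. C j c) ?A")
    case True
    then obtain i k where ik: "i \<in> ?A" "k \<in> ?A" "C i c \<noteq> C k c"
      by (auto simp: separates_def)
    then have "(\<exists>j\<in>?A. C j c = y c)" "(\<exists>j\<in>?A. C j c = 1 - y c)"
      using bit[of i] bit[of k] yc by (metis diff_zero cancel_comm_monoid_add_class.diff_cancel)+
    then show ?thesis
      using True by (simp add: code_dist_off_code_dist[OF c] m A flip_apply)
  next
    case False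
    then have const: "C i c = C j c" if "i \<in> ?A" for i
      using that j False unfolding separates_def by blast
    have "(\<exists>i\<in>?A. C i c = y c) \<longleftrightarrow> C j c = y c"
      "(\<exists>i\<in>?A. C i c = 1 - y c) \<longleftrightarrow> C j c = 1 - y c"
      using const j by metis+
    moreover have "C j c = 1 - y c \<longleftrightarrow> C j c \<noteq> y c"
      using bit[OF j] yc by auto
    ultimately show ?thesis
      using False by (simp add: code_dist_off_code_dist[OF c] m A flip_apply)
  qed
qed

text \<open>
  The exchange principle: off the column \<open>c\<close> the two codes have the same distances and nearest rows,
  and a pair of received words gains exactly when its nearest rows become separated.
\<close>

lemma success_prob_mono_column:
  assumes C: "C \<in> codes n" and D: "D \<in> codes n" and c: "c < n"
    and \<epsilon>: "0 < \<epsilon>" "\<epsilon> < 1 / 2"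
    and off: "\<And>j i. j < 4 \<Longrightarrow> i < n \<Longrightarrow> i \<noteq> c \<Longrightarrow> D j i = C j i"
    and sep: "\<And>y. y \<in> binary_words n \<Longrightarrow> separates (\<lambda>j. C j c) (nearest_rows n c C y) \<Longrightarrow>
      separates (\<lambda>j. D j c) (nearest_rows n c C y)"
  shows "success_prob n C \<epsilon> \<le> success_prob n D \<epsilon>"
proof -
  have dist: "off_dist n c (D j) y = off_dist n c (C j) y" if "j < 4" for j y
    using off that by (intro off_dist_cong) auto
  have A: "nearest_rows n c D y = nearest_rows n c C y" for y
    by (auto simp: nearest_rows_def dist)
  have m: "off_code_dist n c D y = off_code_dist n c C y" for y
    unfolding off_code_dist_def by (intro arg_cong[where f = Min] image_cong) (auto simp: dist)
  have double: "2 * (\<Sum>y\<in>binary_words n. f y) = (\<Sum>y\<in>binary_words n. f y + f (flip c y))"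
    for f :: "(nat \<Rightarrow> nat) \<Rightarrow> real"
  proof -
    have "(\<Sum>y\<in>binary_words n. f (flip c y)) = (\<Sum>y\<in>binary_words n. f y)"
      by (rule sum.reindex_bij_witness[of _ "flip c" "flip c"])
        (simp_all only: flip_binary_words[OF c] flip_flip[OF c])
    then show ?thesis
      by (simp add: sum.distrib)
  qed
  have "(\<Sum>y\<in>binary_words n. likelihood n \<epsilon> (code_dist n C y) +
        likelihood n \<epsilon> (code_dist n C (flip c y)))
      \<le> (\<Sum>y\<in>binary_words n. likelihood n \<epsilon> (code_dist n D y) +
        likelihood n \<epsilon> (code_dist n D (flip c y)))"
  proof (rule sum_mono)
    fix y assume y: "y \<in> binary_words n"
    have "off_code_dist n c C y < n"
      using off_code_dist_le[of 0 n c C y] off_dist_less[OF c, of "C 0" y] by simp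
    then have "likelihood n \<epsilon> (Suc (off_code_dist n c C y)) \<le> likelihood n \<epsilon> (off_code_dist n c C y)"
      by (rule likelihood_Suc_le[OF \<epsilon>])
    then show "likelihood n \<epsilon> (code_dist n C y) + likelihood n \<epsilon> (code_dist n C (flip c y))
        \<le> likelihood n \<epsilon> (code_dist n D y) + likelihood n \<epsilon> (code_dist n D (flip c y))"
      unfolding likelihood_flip_pair[OF C c y] likelihood_flip_pair[OF D c y] A m
      using sep[OF y] by auto
  qed
  then have "(\<Sum>y\<in>binary_words n. likelihood n \<epsilon> (code_dist n C y))
      \<le> (\<Sum>y\<in>binary_words n. likelihood n \<epsilon> (code_dist n D y))"
    using double[of "\<lambda>y. likelihood n \<epsilon> (code_dist n C y)"]
      double[of "\<lambda>y. likelihood n \<epsilon> (code_dist n D y)"] by linarith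
  then show ?thesis
    by (simp add: success_prob_def likelihood_def)
qed

definition set_column :: "(nat \<Rightarrow> nat \<Rightarrow> nat) \<Rightarrow> nat \<Rightarrow> (nat \<Rightarrow> nat) \<Rightarrow> nat \<Rightarrow> nat \<Rightarrow> nat" where
  "set_column C c b = (\<lambda>j\<in>{..<4}. (C j)(c := b j))"

lemma set_column_codes:
  assumes "C \<in> codes n" "c < n" "\<And>j. j < 4 \<Longrightarrow> b j \<in> {0, 1}"
  shows "set_column C c b \<in> codes n"
proof -
  have "(C j)(c := b j) \<in> binary_words n" if "j < 4" for j
    using binary_words_update[OF codes_row[OF assms(1) that] assms(2) assms(3)[OF that]] .
  then show ?thesis
    by (auto simp: set_column_def codes_def)
qed

lemma set_column_apply: "j < 4 \<Longrightarrow> set_column C c b j i = (if i = c then b j else C j i)"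
  by (simp add: set_column_def)

section \<open>Permuting rows and complementing columns\<close>

text \<open>
  Row \<open>\<pi> j\<close> moves to place \<open>j\<close>, and every column whose top entry is then 1 is complemented: the code
  is translated so that its top row becomes the zero word.
\<close>

definition rearrange :: "nat \<Rightarrow> (nat \<Rightarrow> nat) \<Rightarrow> (nat \<Rightarrow> nat \<Rightarrow> nat) \<Rightarrow> nat \<Rightarrow> nat \<Rightarrow> nat" where
  "rearrange n \<pi> C = (\<lambda>j\<in>{..<4}. \<lambda>i\<in>{..<n}. if C (\<pi> j) i = C (\<pi> 0) i then 0 else 1)"

lemma rearrange_codes: "rearrange n \<pi> C \<in> codes n"
  by (auto simp: rearrange_def codes_def binary_words_def)

lemma rearrange_top: "i < n \<Longrightarrow> rearrange n \<pi> C 0 i = 0"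
  by (simp add: rearrange_def)

lemma rearrange_eq_iff:
  assumes C: "C \<in> codes n" and \<pi>: "bij_betw \<pi> {..<4} {..<4}" and "j < 4" "k < 4" "i < n"
  shows "rearrange n \<pi> C j i = rearrange n \<pi> C k i \<longleftrightarrow> C (\<pi> j) i = C (\<pi> k) i"
proof -
  have "\<pi> l < 4" if "l < 4" for l
    using bij_betw_apply[OF \<pi>] that by auto
  then have "C (\<pi> l) i = 0 \<or> C (\<pi> l) i = 1" if "l < 4" for l
    using that codes_bit[OF C _ \<open>i < n\<close>] by blast
  from this[of j] this[of k] this[of 0] show ?thesis
    using assms by (auto simp: rearrange_def)
qed

lemma hamming_dist_rearrange:
  assumes "C \<in> codes n" "bij_betw \<pi> {..<4} {..<4}" "j < 4" "k < 4"
  shows "hamming_dist n (rearrange n \<pi> C j) (rearrange n \<pi> C k) = hamming_dist n (C (\<pi> j)) (C (\<pi> k))"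
  unfolding hamming_dist_def
  by (rule arg_cong[where f = card]) (auto simp: rearrange_eq_iff[OF assms])

lemma success_prob_rearrange:
  assumes C: "C \<in> codes n" and \<pi>: "bij_betw \<pi> {..<4} {..<4}"
  shows "success_prob n (rearrange n \<pi> C) \<epsilon> = success_prob n C \<epsilon>"
proof -
  define \<tau> where "\<tau> y = (\<lambda>i\<in>{..<n}. if y i = C (\<pi> 0) i then 0 else (1::nat))" for y :: "nat \<Rightarrow> nat"
  have \<pi>_less: "\<pi> l < 4" if "l < 4" for l
    using bij_betw_apply[OF \<pi>] that by auto
  have top: "C (\<pi> 0) i = 0 \<or> C (\<pi> 0) i = 1" if "i < n" for i
    using codes_bit[OF C \<pi>_less that] by simp
  have \<tau>_words: "\<tau> y \<in> binary_words n" for y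
    by (auto simp: \<tau>_def binary_words_def)
  have \<tau>_\<tau>: "\<tau> (\<tau> y) = y" if "y \<in> binary_words n" for y
  proof
    fix i
    show "\<tau> (\<tau> y) i = y i"
    proof (cases "i < n")
      case True
      then show ?thesis
        using top[OF True] binary_words_bit[OF that True] by (auto simp: \<tau>_def)
    next
      case False
      then show ?thesis
        using that by (auto simp: \<tau>_def binary_words_def PiE_def extensional_def)
    qed
  qed
  have row: "hamming_dist n (rearrange n \<pi> C j) (\<tau> y) = hamming_dist n (C (\<pi> j)) y"
    if "j < 4" "y \<in> binary_words n" for j y
  proof -
    have "rearrange n \<pi> C j i = \<tau> y i \<longleftrightarrow> C (\<pi> j) i = y i" if i: "i < n" for i
      using top[OF i] codes_bit[OF C \<pi>_less[OF \<open>j < 4\<close>] i] i \<open>j < 4\<close>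
        binary_words_bit[OF \<open>y \<in> binary_words n\<close> i]
      by (auto simp: rearrange_def \<tau>_def)
    then show ?thesis
      unfolding hamming_dist_def by (intro arg_cong[where f = card]) auto
  qed
  have dist: "code_dist n (rearrange n \<pi> C) (\<tau> y) = code_dist n C y" if y: "y \<in> binary_words n" for y
  proof -
    have "(\<lambda>j. hamming_dist n (rearrange n \<pi> C j) (\<tau> y)) ` {..<4} =
        (\<lambda>j. hamming_dist n (C (\<pi> j)) y) ` {..<4}"
      using row y by (intro image_cong) auto
    also have "\<dots> = (\<lambda>j. hamming_dist n (C j) y) ` \<pi> ` {..<4}"
      by (simp add: image_image)
    finally show ?thesis
      by (simp add: code_dist_def bij_betw_imp_surj_on[OF \<pi>])
  qed
  have "(\<Sum>y\<in>binary_words n. likelihood n \<epsilon> (code_dist n C y)) =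
      (\<Sum>y\<in>binary_words n. likelihood n \<epsilon> (code_dist n (rearrange n \<pi> C) y))"
    by (rule sum.reindex_bij_witness[of _ \<tau> \<tau>]) (auto simp: \<tau>_words \<tau>_\<tau> dist)
  then show ?thesis
    by (simp add: success_prob_def likelihood_def)
qed

section \<open>Optimal codes with few unbalanced columns\<close>

definition unbalanced :: "nat \<Rightarrow> (nat \<Rightarrow> nat \<Rightarrow> nat) \<Rightarrow> nat set" where
  "unbalanced n C = {i. i < n \<and> C 0 i + C 1 i + C 2 i + C 3 i \<noteq> 2}"

lemma unbalanced_cases:
  assumes "C \<in> codes n" "c \<in> unbalanced n C"
  obtains (const) "\<And>i j. i < 4 \<Longrightarrow> j < 4 \<Longrightarrow> C i c = C j c"
  | (isolated) j where "j < 4" "\<And>i. i < 4 \<Longrightarrow> i \<noteq> j \<Longrightarrow> C i c \<noteq> C j c"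
proof -
  have c: "c < n" and sum: "C 0 c + C 1 c + C 2 c + C 3 c \<noteq> 2"
    using assms(2) by (auto simp: unbalanced_def)
  have bits: "C 0 c = 0 \<or> C 0 c = 1" "C 1 c = 0 \<or> C 1 c = 1"
    "C 2 c = 0 \<or> C 2 c = 1" "C 3 c = 0 \<or> C 3 c = 1"
    using codes_bit[OF assms(1) _ c] by simp_all
  have "(\<forall>i<4. \<forall>j<4. C i c = C j c) \<or> (\<exists>j<4. \<forall>i<4. i \<noteq> j \<longrightarrow> C i c \<noteq> C j c)"
    unfolding all_less_4 ex_less_4 using bits sum by (elim disjE) simp_all
  then show ?thesis
    using const isolated by blast
qed

lemma unbalanced_set_column:
  assumes "c \<in> unbalanced n C" "b 0 + b 1 + b 2 + b 3 = 2"
  shows "card (unbalanced n (set_column C c b)) < card (unbalanced n C)"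
proof (rule psubset_card_mono)
  show "finite (unbalanced n C)"
    by (simp add: unbalanced_def)
  show "unbalanced n (set_column C c b) \<subset> unbalanced n C"
    using assms by (auto simp: unbalanced_def set_column_apply)
qed

lemma optimal_code_exists:
  obtains C where "optimal_code n \<epsilon> C"
proof -
  have "(\<lambda>j\<in>{..<4}. \<lambda>i\<in>{..<n}. 0) \<in> codes n"
    by (auto simp: codes_def binary_words_def)
  then have "(\<lambda>C. success_prob n C \<epsilon>) ` codes n \<noteq> {}"
    by auto
  then have "Max ((\<lambda>C. success_prob n C \<epsilon>) ` codes n) \<in> (\<lambda>C. success_prob n C \<epsilon>) ` codes n"
    by (intro Max_in) (auto simp: finite_codes)
  then obtain C where "C \<in> codes n" "success_prob n C \<epsilon> = Max ((\<lambda>C. success_prob n C \<epsilon>) ` codes n)"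
    by auto
  then have "optimal_code n \<epsilon> C"
    by (auto simp: optimal_code_def finite_codes)
  then show ?thesis
    by (rule that)
qed

lemma optimal_code_mono:
  assumes "optimal_code n \<epsilon> C" "D \<in> codes n" "success_prob n C \<epsilon> \<le> success_prob n D \<epsilon>"
  shows "optimal_code n \<epsilon> D"
  using assms unfolding optimal_code_def by (meson order_trans)

definition least_unbalanced_optimal :: "nat \<Rightarrow> real \<Rightarrow> (nat \<Rightarrow> nat \<Rightarrow> nat) \<Rightarrow> bool" where
  "least_unbalanced_optimal n \<epsilon> C \<longleftrightarrow> optimal_code n \<epsilon> C \<and>
    (\<forall>D. optimal_code n \<epsilon> D \<longrightarrow> card (unbalanced n C) \<le> card (unbalanced n D))"

lemma least_unbalanced_optimal_exists:
  obtains C where "least_unbalanced_optimal n \<epsilon> C"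
proof -
  obtain C where "optimal_code n \<epsilon> C"
    by (rule optimal_code_exists)
  then obtain D where "optimal_code n \<epsilon> D"
    "\<forall>E. optimal_code n \<epsilon> E \<longrightarrow> card (unbalanced n D) \<le> card (unbalanced n E)"
    using ex_has_least_nat[of "optimal_code n \<epsilon>" C "\<lambda>D. card (unbalanced n D)"] by blast
  then show ?thesis
    by (intro that) (simp add: least_unbalanced_optimal_def)
qed

text \<open>
  Replacing an unbalanced column by the balanced \<open>b\<close> would contradict minimality if it did not lower
  the success probability, so by the exchange principle some word witnesses that \<open>b\<close> is worse.
\<close>

lemma no_balanced_exchange:
  assumes least: "least_unbalanced_optimal n \<epsilon> C" and \<epsilon>: "0 < \<epsilon>" "\<epsilon> < 1 / 2"
    and c: "c \<in> unbalanced n C"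
    and b: "\<And>j. j < 4 \<Longrightarrow> b j \<in> {0, 1}" "b 0 + b 1 + b 2 + b 3 = 2"
  obtains y where "y \<in> binary_words n" "separates (\<lambda>j. C j c) (nearest_rows n c C y)"
    "\<not> separates b (nearest_rows n c C y)"
proof -
  have opt: "optimal_code n \<epsilon> C" and C: "C \<in> codes n"
    using least by (auto simp: least_unbalanced_optimal_def optimal_code_def)
  have c_less: "c < n"
    using c by (simp add: unbalanced_def)
  let ?D = "set_column C c b"
  have D: "?D \<in> codes n"
    using C c_less b(1) by (rule set_column_codes)
  have col: "separates (\<lambda>j. ?D j c) (nearest_rows n c C y) \<longleftrightarrow> separates b (nearest_rows n c C y)"
    for y
    by (auto simp: separates_def nearest_rows_def set_column_apply)
  have "\<not> success_prob n C \<epsilon> \<le> success_prob n ?D \<epsilon>"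
    using optimal_code_mono[OF opt D] unbalanced_set_column[of c n C b, OF c b(2)] least
    by (auto simp: least_unbalanced_optimal_def not_less[symmetric])
  then show ?thesis
    using success_prob_mono_column[OF C D c_less \<epsilon>] that col by (auto simp: set_column_apply)
qed

text \<open>
  Here parity enters: were row \<open>i\<close> at even distance from the isolated row \<open>j\<close>, the two rows would be
  at odd distance off \<open>c\<close> and never nearest together, so pairing \<open>i\<close> with \<open>j\<close> would cost nothing.
\<close>

lemma unbalanced_isolates_odd_row:
  assumes least: "least_unbalanced_optimal n \<epsilon> C" and \<epsilon>: "0 < \<epsilon>" "\<epsilon> < 1 / 2"
    and c: "c \<in> unbalanced n C"
  obtains j where "j < 4" "\<And>i. i < 4 \<Longrightarrow> i \<noteq> j \<Longrightarrow> C i c \<noteq> C j c"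
    "\<And>i. i < 4 \<Longrightarrow> i \<noteq> j \<Longrightarrow> odd (hamming_dist n (C i) (C j))"
proof -
  have C: "C \<in> codes n"
    using least by (auto simp: least_unbalanced_optimal_def optimal_code_def)
  have c_less: "c < n"
    using c by (simp add: unbalanced_def)
  show ?thesis
    using C c
  proof (cases rule: unbalanced_cases)
    case const
    let ?b = "\<lambda>j. if j < 2 then 0 else 1 :: nat"
    obtain y where "separates (\<lambda>j. C j c) (nearest_rows n c C y)"
      by (rule no_balanced_exchange[OF least \<epsilon> c, of ?b]) auto
    then show ?thesis
      using const unfolding separates_def nearest_rows_def by blast
  next
    case (isolated j)
    have "odd (hamming_dist n (C i) (C j))" if i: "i < 4" "i \<noteq> j" for i
    proof
      assume even: "even (hamming_dist n (C i) (C j))"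
      let ?b = "\<lambda>k. if k = i \<or> k = j then 1 else 0 :: nat"
      have "?b 0 + ?b 1 + ?b 2 + ?b 3 = 2"
        using i isolated(1) unfolding less_4_iff by auto
      then obtain y where y: "y \<in> binary_words n"
        and sep: "separates (\<lambda>j. C j c) (nearest_rows n c C y)"
        and not_sep: "\<not> separates ?b (nearest_rows n c C y)"
        by (rule no_balanced_exchange[OF least \<epsilon> c, of ?b, rotated]) auto
      let ?A = "nearest_rows n c C y"
      obtain k l where kl: "k \<in> ?A" "l \<in> ?A" "C k c \<noteq> C l c"
        using sep by (auto simp: separates_def)
      have less: "l' < 4" if "l' \<in> ?A" for l'
        using that by (simp add: nearest_rows_iff)
      \<comment> \<open>The three other rows agree at \<open>c\<close>, so one of two rows that differ there is row \<open>j\<close>.\<close>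
      have "k = j \<or> l = j"
        using kl isolated(2)[of k] isolated(2)[of l] less codes_bit[OF C _ c_less] isolated(1)
        by metis
      then obtain m where j: "j \<in> ?A" and m: "m \<in> ?A" "m \<noteq> j"
        using kl by metis
      have "i \<in> ?A"
        using not_sep j m unfolding separates_def by (metis zero_neq_one)
      then have "off_dist n c (C i) y = off_dist n c (C j) y"
        using j by (simp add: nearest_rows_iff)
      then have "even (off_dist n c (C i) (C j))"
        using even_off_dist_triangle[OF codes_row[OF C i(1)] y codes_row[OF C isolated(1)], of c]
        by simp
      then show False
        using even isolated(2)[OF i] by (simp add: hamming_dist_off_dist[OF c_less])
    qed
    then show ?thesis
      using isolated that by blast
  qed
qed

section \<open>Recognising Class-I and linear codes\<close>

lemma column_type_eqD:
  assumes "C \<in> codes n" "i < n" "i' < n" "column_type C i = column_type C i'" "j < 4"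
  shows "C j i = C j i'"
proof -
  have le: "C k i \<le> 1 \<and> C k i' \<le> 1" if "k < 4" for k
    using codes_bit[OF assms(1) that assms(2)] codes_bit[OF assms(1) that assms(3)] by auto
  have bits: "C 0 i \<le> 1 \<and> C 0 i' \<le> 1" "C 1 i \<le> 1 \<and> C 1 i' \<le> 1"
    "C 2 i \<le> 1 \<and> C 2 i' \<le> 1" "C 3 i \<le> 1 \<and> C 3 i' \<le> 1"
    using le[of 0] le[of 1] le[of 2] le[of 3] by linarith+
  note eq = assms(4)[unfolded column_type_def]
  have 0: "C 0 i = C 0 i'"
    using eq bits by linarith
  have 1: "C 1 i = C 1 i'"
    using eq bits 0 by linarith
  have 2: "C 2 i = C 2 i'"
    using eq bits 0 1 by linarith
  have "C 3 i = C 3 i'"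
    using eq 0 1 2 by linarith
  with 0 1 2 show ?thesis
    using assms(5) by (auto simp: less_4_iff)
qed

lemma balanced_column_type:
  assumes "C \<in> codes n" "i < n" "C 0 i = 0" "i \<notin> unbalanced n C"
  shows "column_type C i \<in> {3, 5, 6}"
proof -
  have "C 1 i = 0 \<or> C 1 i = 1" "C 2 i = 0 \<or> C 2 i = 1" "C 3 i = 0 \<or> C 3 i = 1"
    using codes_bit[OF assms(1) _ assms(2)] by simp_all
  then show ?thesis
    using assms(2-4) by (auto simp: column_type_def unbalanced_def)
qed

text \<open>Permuting the four entries of a column keeps their sum, and complementing turns a sum of 2 into 2.\<close>

lemma unbalanced_rearrange:
  assumes C: "C \<in> codes n" and \<pi>: "bij_betw \<pi> {..<4} {..<4}"
  shows "unbalanced n (rearrange n \<pi> C) = unbalanced n C"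
proof -
  have "rearrange n \<pi> C 0 i + rearrange n \<pi> C 1 i + rearrange n \<pi> C 2 i + rearrange n \<pi> C 3 i = 2
      \<longleftrightarrow> C 0 i + C 1 i + C 2 i + C 3 i = 2" if i: "i < n" for i
  proof -
    have ends: "{..<4} = {0, 1, 2, 3::nat}"
      by auto
    have "(\<Sum>j<4. C (\<pi> j) i) = (\<Sum>j<4. C j i)"
      by (rule sum.reindex_bij_betw[OF \<pi>])
    then have sum: "C (\<pi> 0) i + C (\<pi> 1) i + C (\<pi> 2) i + C (\<pi> 3) i = C 0 i + C 1 i + C 2 i + C 3 i"
      by (simp add: ends)
    have bit: "C (\<pi> j) i = 0 \<or> C (\<pi> j) i = 1" if "j < 4" for j
      using codes_bit[OF C _ i] bij_betw_apply[OF \<pi>] that by auto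
    have "C (\<pi> 0) i = 0 \<or> C (\<pi> 0) i = 1" "C (\<pi> 1) i = 0 \<or> C (\<pi> 1) i = 1"
      "C (\<pi> 2) i = 0 \<or> C (\<pi> 2) i = 1" "C (\<pi> 3) i = 0 \<or> C (\<pi> 3) i = 1"
      using bit by simp_all
    then show ?thesis
      using i unfolding sum[symmetric] by (elim disjE) (simp_all add: rearrange_def)
  qed
  then show ?thesis
    by (auto simp: unbalanced_def)
qed

text \<open>
  The odd distances from the last row are \<open>|1| + |3| + |5|\<close>, \<open>|1| + |3| + |6|\<close> and \<open>|1| + |5| + |6|\<close>
  in terms of the type counts. Comparing them shows that \<open>|3|\<close>, \<open>|5|\<close> and \<open>|6|\<close> have the same parity,
  and then \<open>|1|\<close> must be odd.
\<close>

lemma class_I_code_if_odd_dist: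
  assumes types: "\<And>i. i < n \<Longrightarrow> column_type C i \<in> {1, 3, 5, 6}"
    and C: "C \<in> codes n"
    and dist: "\<And>j. j < 3 \<Longrightarrow> odd (hamming_dist n (C j) (C 3))"
  shows "class_I_code n C"
proof -
  let ?T = "\<lambda>t. {i. i < n \<and> column_type C i = t}"
  have decode:
    "column_type C i = 1 \<and> C 0 i = 0 \<and> C 1 i = 0 \<and> C 2 i = 0 \<and> C 3 i = 1 \<or>
     column_type C i = 3 \<and> C 0 i = 0 \<and> C 1 i = 0 \<and> C 2 i = 1 \<and> C 3 i = 1 \<or>
     column_type C i = 5 \<and> C 0 i = 0 \<and> C 1 i = 1 \<and> C 2 i = 0 \<and> C 3 i = 1 \<or>
     column_type C i = 6 \<and> C 0 i = 0 \<and> C 1 i = 1 \<and> C 2 i = 1 \<and> C 3 i = 0" if i: "i < n" for i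
  proof -
    have "C 0 i = 0 \<or> C 0 i = 1" "C 1 i = 0 \<or> C 1 i = 1" "C 2 i = 0 \<or> C 2 i = 1" "C 3 i = 0 \<or> C 3 i = 1"
      using codes_bit[OF C _ i] by simp_all
    then show ?thesis
      using types[OF i] unfolding column_type_def by (elim disjE) simp_all
  qed
  have "{i. i < n \<and> C 0 i \<noteq> C 3 i} = ?T 1 \<union> ?T 3 \<union> ?T 5"
    "{i. i < n \<and> C 1 i \<noteq> C 3 i} = ?T 1 \<union> ?T 3 \<union> ?T 6"
    "{i. i < n \<and> C 2 i \<noteq> C 3 i} = ?T 1 \<union> ?T 5 \<union> ?T 6"
    using decode by force+
  moreover have "card (?T r \<union> ?T s \<union> ?T t) = type_count n C r + type_count n C s + type_count n C t"
    if "r \<noteq> s" "r \<noteq> t" "s \<noteq> t" for r s t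
    unfolding type_count_def using that by (subst card_Un_disjoint; (subst card_Un_disjoint)?) auto
  ultimately have
    "hamming_dist n (C 0) (C 3) = type_count n C 1 + type_count n C 3 + type_count n C 5"
    "hamming_dist n (C 1) (C 3) = type_count n C 1 + type_count n C 3 + type_count n C 6"
    "hamming_dist n (C 2) (C 3) = type_count n C 1 + type_count n C 5 + type_count n C 6"
    by (simp_all add: hamming_dist_def)
  then have "odd (type_count n C 1 + type_count n C 3 + type_count n C 5)"
    "odd (type_count n C 1 + type_count n C 3 + type_count n C 6)"
    "odd (type_count n C 1 + type_count n C 5 + type_count n C 6)"
    using dist[of 0] dist[of 1] dist[of 2] by simp_all
  then show ?thesis
    using types by (auto simp: class_I_code_def)
qed

lemma linear_code_if_two_types:
  assumes types: "\<And>i. i < n \<Longrightarrow> column_type C i \<in> {3, 5, 6}"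
    and "i < n" "k < n" "column_type C i \<noteq> column_type C k"
  shows "linear_code n C"
proof -
  have pos: "type_count n C (column_type C l) > 0" if "l < n" for l
    using that unfolding type_count_def by (subst card_gt_0_iff) auto
  have "card {column_type C i, column_type C k} \<le> card {t \<in> {3, 5, 6}. type_count n C t > 0}"
    using assms types[of i] types[of k] pos[of i] pos[of k] by (intro card_mono) auto
  then show ?thesis
    using assms types by (auto simp: linear_code_def)
qed

text \<open>
  The row at odd distance from the others is the same for all unbalanced columns. Swapping it into the
  last place and making the top row zero gives those columns type 1.
\<close>

lemma optimal_class_I_code:
  assumes least: "least_unbalanced_optimal n \<epsilon> C" and \<epsilon>: "0 < \<epsilon>" "\<epsilon> < 1 / 2"
    and nonempty: "unbalanced n C \<noteq> {}"
  shows "\<exists>D. class_I_code n D \<and> optimal_code n \<epsilon> D"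
proof -
  have opt: "optimal_code n \<epsilon> C" and C: "C \<in> codes n"
    using least by (auto simp: least_unbalanced_optimal_def optimal_code_def)
  obtain c where "c \<in> unbalanced n C"
    using nonempty by blast
  then obtain j where j: "j < 4"
    and odd_j: "\<And>i. i < 4 \<Longrightarrow> i \<noteq> j \<Longrightarrow> odd (hamming_dist n (C i) (C j))"
    using unbalanced_isolates_odd_row[OF least \<epsilon>] by blast
  have isolates: "C i c' \<noteq> C j c'" if c': "c' \<in> unbalanced n C" and i: "i < 4" "i \<noteq> j" for c' i
  proof -
    obtain k where k: "k < 4" and col: "\<And>i. i < 4 \<Longrightarrow> i \<noteq> k \<Longrightarrow> C i c' \<noteq> C k c'"
      and odd_k: "\<And>i. i < 4 \<Longrightarrow> i \<noteq> k \<Longrightarrow> odd (hamming_dist n (C i) (C k))"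
      using unbalanced_isolates_odd_row[OF least \<epsilon> c'] by blast
    have "k = j"
    proof (rule ccontr)
      assume "k \<noteq> j"
      \<comment> \<open>A third row would form a triangle with three odd sides.\<close>
      obtain l where l: "l < 4" "l \<noteq> j" "l \<noteq> k"
      proof -
        have "card {j, k} < card {..<4::nat}"
          by (simp add: card_insert_if)
        then have "\<not> {..<4} \<subseteq> {j, k}"
          using card_mono[of "{j, k}" "{..<4}"] by fastforce
        then show ?thesis
          using that by blast
      qed
      show False
        using even_hamming_dist_triangle[of "C j" n "C k" "C l"] codes_row[OF C] j k l \<open>k \<noteq> j\<close>
          odd_j[of l] odd_k[of j] odd_k[of l] hamming_dist_commute[of n "C j" "C l"]
        by simp
    qed
    then show ?thesis
      using col i by blast
  qed
  define \<pi> where "\<pi> = transpose j (3::nat)"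
  have \<pi>: "bij_betw \<pi> {..<4} {..<4}"
    using j by (intro bij_betw_byWitness[of _ \<pi>]) (auto simp: \<pi>_def transpose_def)
  have \<pi>3: "\<pi> 3 = j"
    by (simp add: \<pi>_def)
  have \<pi>_less: "\<pi> i < 4" if "i < 4" for i
    using bij_betw_apply[OF \<pi>] that by auto
  have \<pi>_ne: "\<pi> i \<noteq> j" if "i < 3" for i
    using that by (auto simp: \<pi>_def transpose_def)
  let ?D = "rearrange n \<pi> C"
  have D: "?D \<in> codes n"
    by (rule rearrange_codes)
  have "column_type ?D i \<in> {1, 3, 5, 6}" if i: "i < n" for i
  proof (cases "i \<in> unbalanced n ?D")
    case True
    have "?D k i \<noteq> ?D 3 i" if k: "k < 3" for k
      using isolates[of i "\<pi> k"] True \<pi>_less[of k] \<pi>_ne[OF k] k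
      by (simp add: rearrange_eq_iff[OF C \<pi> _ _ i] \<pi>3 unbalanced_rearrange[OF C \<pi>])
    from this[of 0] this[of 1] this[of 2] have "?D 0 i \<noteq> ?D 3 i" "?D 1 i \<noteq> ?D 3 i" "?D 2 i \<noteq> ?D 3 i"
      by simp_all
    moreover have "?D 1 i = 0 \<or> ?D 1 i = 1" "?D 2 i = 0 \<or> ?D 2 i = 1" "?D 3 i = 0 \<or> ?D 3 i = 1"
      using codes_bit[OF D _ i] by simp_all
    ultimately show ?thesis
      by (auto simp: column_type_def rearrange_top[OF i])
  next
    case False
    then show ?thesis
      using balanced_column_type[OF D i] by (auto simp: rearrange_top[OF i])
  qed
  moreover have "odd (hamming_dist n (?D i) (?D 3))" if "i < 3" for i
    using odd_j[of "\<pi> i"] that \<pi>_less[of i] \<pi>_ne[of i]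
    by (simp add: hamming_dist_rearrange[OF C \<pi>] \<pi>3)
  ultimately have "class_I_code n ?D"
    by (intro class_I_code_if_odd_dist D)
  moreover have "optimal_code n \<epsilon> ?D"
    using optimal_code_mono[OF opt D] by (simp add: success_prob_rearrange[OF C \<pi>])
  ultimately show ?thesis
    by blast
qed

text \<open>
  The only balanced codes that are not linear after normalisation repeat a single column. Then there
  are just two distinct rows, each occurring twice. If both are nearest to a word off the first column,
  all four rows are, and every nonconstant column separates them; so the first column may be exchanged.
\<close>

lemma optimal_linear_code:
  assumes n: "n \<ge> 2" and \<epsilon>: "0 < \<epsilon>" "\<epsilon> < 1 / 2"
    and opt: "optimal_code n \<epsilon> C" and balanced: "unbalanced n C = {}"
  shows "\<exists>D. linear_code n D \<and> optimal_code n \<epsilon> D"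
proof -
  have C: "C \<in> codes n"
    using opt by (simp add: optimal_code_def)
  let ?D = "rearrange n id C"
  have D: "?D \<in> codes n"
    by (rule rearrange_codes)
  have id: "bij_betw id {..<4::nat} {..<4}"
    by simp
  have D_opt: "optimal_code n \<epsilon> ?D"
    using optimal_code_mono[OF opt D] by (simp add: success_prob_rearrange[OF C id])
  have types: "column_type ?D i \<in> {3, 5, 6}" if i: "i < n" for i
    using balanced_column_type[OF D i] balanced
    by (simp add: rearrange_top[OF i] unbalanced_rearrange[OF C id])
  show ?thesis
  proof (cases "\<exists>i<n. column_type ?D i \<noteq> column_type ?D 0")
    case True
    then have "linear_code n ?D"
      using linear_code_if_two_types[OF types] n by auto
    then show ?thesis
      using D_opt by blast
  next
    case False
    have n0: "0 < n"
      using n by simp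
    have same_type: "column_type ?D i = column_type ?D 0" if "i < n" for i
      using False that by blast
    have const: "?D j i = ?D j 0" if "i < n" "j < 4" for i j
      using column_type_eqD[OF D that(1) n0 same_type[OF that(1)] that(2)] .
    \<comment> \<open>The new column is of type 5 or 3, whichever differs from the common type.\<close>
    define b :: "nat \<Rightarrow> nat" where
      "b = (\<lambda>j. if column_type ?D 0 = 3 then (if j \<in> {1, 3} then 1 else 0)
        else (if j \<in> {2, 3} then 1 else 0))"
    let ?E = "set_column ?D 0 b"
    have E: "?E \<in> codes n"
      by (rule set_column_codes[OF D n0]) (auto simp: b_def)
    have "column_type ?E 0 = 8 * b 0 + 4 * b 1 + 2 * b 2 + b 3"
      by (simp add: column_type_def set_column_apply)
    then have b_type: "column_type ?E 0 = (if column_type ?D 0 = 3 then 5 else 3)"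
      by (simp add: b_def)
    have other_type: "column_type ?E i = column_type ?D 0" if "i < n" "i \<noteq> 0" for i
      using same_type[OF that(1)] that(2) by (simp add: column_type_def set_column_apply)
    have "column_type ?E i \<in> {3, 5, 6}" if "i < n" for i
      using types[OF n0] b_type other_type[OF that] by (cases "i = 0") auto
    then have "linear_code n ?E"
      using linear_code_if_two_types[of n ?E 0 1] b_type other_type[of 1] n by auto
    moreover have "success_prob n ?D \<epsilon> \<le> success_prob n ?E \<epsilon>"
    proof (rule success_prob_mono_column[OF D E n0 \<epsilon>])
      fix y assume sep: "separates (\<lambda>j. ?D j 0) (nearest_rows n 0 ?D y)"
      let ?A = "nearest_rows n 0 ?D y"
      obtain i k where ik: "i \<in> ?A" "k \<in> ?A" "?D i 0 \<noteq> ?D k 0"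
        using sep by (auto simp: separates_def)
      have near: "l \<in> ?A" if l: "l < 4" for l
      proof -
        have "?D l 0 = ?D i 0 \<or> ?D l 0 = ?D k 0"
          using codes_bit[OF D _ n0] ik l by (metis nearest_rows_iff)
        then obtain m where m: "m \<in> ?A" "?D l 0 = ?D m 0"
          using ik by blast
        then have "m < 4"
          by (simp add: nearest_rows_iff)
        have "?D l i' = ?D m i'" if "i' < n" for i'
          using const[OF that l] const[OF that \<open>m < 4\<close>] m(2) by metis
        then have "off_dist n 0 (?D l) y = off_dist n 0 (?D m) y"
          by (intro off_dist_cong) auto
        then show ?thesis
          using m l by (simp add: nearest_rows_iff)
      qed
      have "?E 0 0 \<noteq> ?E 3 0"
        by (simp add: set_column_apply b_def)
      then show "separates (\<lambda>j. ?E j 0) ?A"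
        using near[of 0] near[of 3] by (auto simp: separates_def)
    qed (simp add: set_column_apply)
    then have "optimal_code n \<epsilon> ?E"
      by (rule optimal_code_mono[OF D_opt E])
    ultimately show ?thesis
      by blast
  qed
qed

theorem theorem1:
  fixes n :: nat and \<epsilon> :: real
  assumes "n \<ge> 2" and "0 < \<epsilon>" and "\<epsilon> < 1 / 2"
  shows "\<exists>C\<in>codes n. (linear_code n C \<or> class_I_code n C) \<and> optimal_code n \<epsilon> C"
proof -
  obtain C where least: "least_unbalanced_optimal n \<epsilon> C"
    by (rule least_unbalanced_optimal_exists)
  then have opt: "optimal_code n \<epsilon> C"
    by (simp add: least_unbalanced_optimal_def)
  have "\<exists>D. (linear_code n D \<or> class_I_code n D) \<and> optimal_code n \<epsilon> D"
    using optimal_class_I_code[OF least assms(2,3)] optimal_linear_code[OF assms opt]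
    by blast
  then show ?thesis
    by (auto simp: optimal_code_def)
qed

end
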